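(* Assume the Collatz conjecture. For $n=1,2,\dots,14$ the number of Collatz permutations of length $n$ is exactly $F_n$, and for every integer $n\geq 15$ the number of Collatz permutations of length $n$ is strictly greater than $F_n$.
   Context: $F_n$ denotes the $n$-th Fibonacci number, with $F_1=F_2=1$ and $F_n=F_{n-1}+F_{n-2}$ for $n>2$. The Collatz map on positive integers is $f(x)=x/2$ if $x$ is even and $f(x)=3x+1$ if $x$ is odd. The Collatz conjecture (a standing assumption of the paper) states that for every positive integer $x$ some iterate $f^{m}(x)$ equals $1$. Let $x$ be a positive integer that is not a power of two (here $1=2^0$ counts as a power of two). The trace of $x$ is the finite sequence $x, f(x), f^2(x),\dots,f^{n-1}(x)$ of iterates strictly before the first power of two in the orbit; that is, $n\ge 1$ is the least integer such that $f^{n}(x)$ is a power of two. The elements of a trace are distinct. The Collatz permutation $C(x)$ is the permutation of $\{1,\dots,n\}$, in one-line notation, obtained from the trace of $x$ by replacing each element by its rank (the $i$-th smallest element is replaced by $i$). A Collatz permutation of length $n$ is a permutation of $\{1,\dots,n\}$ equal to $C(x)$ for some such $x$. *)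

theory Defs
  imports Complex_Main "HOL-Number_Theory.Fib" "HOL-Combinatorics.Multiset_Permutations"
begin

definition collatz :: "nat \<Rightarrow> nat" where
  "collatz x = (if even x then x div 2 else 3 * x + 1)"

definition collatz_conjecture :: bool where
  "collatz_conjecture \<longleftrightarrow> (\<forall>x>0. \<exists>m. (collatz ^^ m) x = 1)"

definition power_of_two :: "nat \<Rightarrow> bool" where
  "power_of_two x \<longleftrightarrow> (\<exists>k. x = 2 ^ k)"

(* The next three functions are meaningful only for positive x that is not a power of two
   and whose orbit reaches a power of two. *)
definition trace_length :: "nat \<Rightarrow> nat" where
  "trace_length x = (LEAST n. n \<ge> 1 \<and> power_of_two ((collatz ^^ n) x))"

definition trace :: "nat \<Rightarrow> nat list" where
  "trace x = map (\<lambda>i. (collatz ^^ i) x) [0..<trace_length x]"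

(* Ranks start at 1, so the result is a permutation of {1..n} in one-line notation. *)
definition collatz_permutation :: "nat \<Rightarrow> nat list" where
  "collatz_permutation x = map (\<lambda>a. card {b \<in> set (trace x). b \<le> a}) (trace x)"

definition collatz_permutations :: "nat \<Rightarrow> nat list set" where
  "collatz_permutations n =
    {p \<in> permutations_of_set {1..n}.
      \<exists>x>0. \<not> power_of_two x \<and> p = collatz_permutation x}"

end

theory Submission
  imports Defs "HOL-Number_Theory.Cong"
begin

text \<open>
  The Collatz map increases its argument exactly at odd numbers, so the ascents of the Collatz
  permutation of \<open>x\<close> reveal the parities of all elements of the trace
  (\<open>ascents_collatz_permutation\<close>).  An odd element is followed by an even one, and the last
  element is odd because its successor, unlike itself, is a power of two.  Words of
  length \<open>n\<close> with these two properties are counted by \<open>fib n\<close> (\<open>card_parity_words\<close>), and each of them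
  is the parity word of a trace: the word can be read backwards from a number \<open>(4 ^ m - 1) / 3\<close>,
  whose successor is \<open>4 ^ m\<close>, because these numbers meet every residue class modulo every power
  of \<open>3\<close> and hence permit any sequence of backward steps (\<open>exists_large_parity_word\<close>).  So \<open>ascents\<close>
  maps the Collatz permutations of length \<open>n\<close> onto a set of size \<open>fib n\<close>, and the question is for
  which \<open>n\<close> this map is injective.

  A run of \<open>l\<close> steps, \<open>a\<close> of them upwards and \<open>b\<close> downwards, maps \<open>y\<close> to \<open>(3 ^ a * y + c) / 2 ^ b\<close>,
  where \<open>c\<close> depends only on the parities.  If \<open>3 ^ a > 2 ^ b\<close>, the run ends above \<open>y\<close>.  If
  \<open>3 ^ a < 2 ^ b\<close>, it ends below \<open>y\<close>, unless \<open>y\<close> is at most \<open>c / (2 ^ b - 3 ^ a)\<close>; call the exceptions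
  anomalies.  Without anomalies the parities determine the order of the trace.  A trace
  of length at most \<open>14\<close> has only runs of at most \<open>13\<close> steps, for which anomalies start at small
  numbers (\<open>anomaly_small\<close>), and inspecting these shows that there are none (\<open>less_iff_slope\<close>); so
  \<open>ascents\<close> is injective.

  The trace of \<open>9\<close> has length \<open>15\<close> and contains an anomaly: \<open>13\<close> steps lead from \<open>9\<close> to \<open>10\<close>, although
  the slope is \<open>243 / 256\<close>.  Prefixing halvings, the trace of \<open>2 ^ k * 9\<close> has the same anomaly and
  length \<open>15 + k\<close>.  Its parity word is also that of some very large number, in whose trace these
  \<open>13\<close> steps do lead downwards.  So one word comes from two permutations
  (\<open>not_inj_on_ascents\<close>).
\<close>

section \<open>Stopping at a power of two\<close>

lemma power_of_two_double [simp]: "power_of_two (2 * x) \<longleftrightarrow> power_of_two x"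
proof
  assume "power_of_two (2 * x)"
  then obtain k where k: "2 * x = 2 ^ k"
    by (auto simp: power_of_two_def)
  then show "power_of_two x"
    by (cases k) (auto simp: power_of_two_def)
next
  assume "power_of_two x"
  then show "power_of_two (2 * x)"
    unfolding power_of_two_def by (metis power_Suc)
qed

lemma odd_power_of_two: "odd x \<Longrightarrow> power_of_two x \<Longrightarrow> x = 1"
  by (auto simp: power_of_two_def)

lemma not_power_of_two_0 [simp]: "\<not> power_of_two 0"
  by (simp add: power_of_two_def)

lemma power_of_two_collatz:
  assumes "power_of_two x"
  shows "power_of_two (collatz x)"
proof (cases "even x")
  case True
  then show ?thesis
    using assms by (auto simp: collatz_def elim!: evenE)
next
  case False
  then have "x = 1"
    using assms odd_power_of_two by blast
  moreover have "power_of_two 4"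
    unfolding power_of_two_def by (rule exI[of _ 2]) simp
  ultimately show ?thesis
    by (simp add: collatz_def)
qed

text \<open>
  The first power of two in the orbit of \<open>x\<close> appears after exactly \<open>n\<close> steps.  For \<open>n \<ge> 1\<close> this says that
  \<open>x\<close> has a trace of length \<open>n\<close>, and the recursion allows induction along the trace.
\<close>

fun hits :: "nat \<Rightarrow> nat \<Rightarrow> bool" where
  "hits x 0 \<longleftrightarrow> power_of_two x"
| "hits x (Suc n) \<longleftrightarrow> \<not> power_of_two x \<and> hits (collatz x) n"

lemma hits_imp_power_of_two: "hits x n \<Longrightarrow> power_of_two ((collatz ^^ n) x)"
  by (induction n arbitrary: x) (auto simp del: funpow.simps simp: funpow_Suc_right)

lemma hits_funpow: "hits x n \<Longrightarrow> i \<le> n \<Longrightarrow> hits ((collatz ^^ i) x) (n - i)"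
proof (induction i arbitrary: x n)
  case (Suc i)
  then obtain m where "n = Suc m"
    by (cases n) auto
  with Suc show ?case
    by (simp del: funpow.simps add: funpow_Suc_right)
qed simp

lemma hits_not_power_of_two:
  assumes "hits x n" "i < n"
  shows "\<not> power_of_two ((collatz ^^ i) x)"
  using hits_funpow[OF assms(1), of i] assms(2) by (cases "n - i") auto

lemma hits_pos: "hits x n \<Longrightarrow> x > 0"
proof (induction n arbitrary: x)
  case 0
  then show ?case
    by (cases x) auto
next
  case (Suc n)
  then have "collatz x > 0"
    by simp
  then show ?case
    by (cases x) (auto simp: collatz_def)
qed

lemma trace_length_eqI:
  assumes "hits x n" "n \<ge> 1"
  shows "trace_length x = n"
  unfolding trace_length_def
proof (rule Least_equality)
  show "1 \<le> n \<and> power_of_two ((collatz ^^ n) x)"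
    using assms hits_imp_power_of_two by blast
  show "n \<le> m" if "1 \<le> m \<and> power_of_two ((collatz ^^ m) x)" for m
    using hits_not_power_of_two[OF assms(1)] that by (meson not_le)
qed

lemma hits_trace_length:
  assumes "collatz_conjecture" "x > 0" "\<not> power_of_two x"
  shows "hits x (trace_length x)" "trace_length x \<ge> 1"
proof -
  have "\<exists>n. hits x n" if "power_of_two ((collatz ^^ m) x)" for m x
    using that
  proof (induction m arbitrary: x)
    case 0
    then have "hits x 0"
      by simp
    then show ?case ..
  next
    case (Suc m)
    then obtain n where "hits (collatz x) n"
      by (auto simp del: funpow.simps simp: funpow_Suc_right)
    then show ?case
      by (cases "power_of_two x") (meson hits.simps)+
  qed
  moreover obtain m where "(collatz ^^ m) x = 1"
    using assms(1,2) unfolding collatz_conjecture_def by blast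
  moreover have "power_of_two 1"
    unfolding power_of_two_def by (rule exI[of _ 0]) simp
  ultimately obtain n where n: "hits x n"
    by metis
  have "n \<ge> 1"
    using n assms(3) by (cases n) auto
  then show "hits x (trace_length x)" "trace_length x \<ge> 1"
    using trace_length_eqI[OF n] n by auto
qed

lemma length_trace [simp]: "length (trace x) = trace_length x"
  by (simp add: trace_def)

lemma nth_trace: "i < trace_length x \<Longrightarrow> trace x ! i = (collatz ^^ i) x"
  by (simp add: trace_def)

text \<open>
  A repeated element would make the orbit periodic from there on, so the power of two that follows
  the trace would already occur within it.
\<close>

lemma distinct_trace:
  assumes "hits x n" "n \<ge> 1"
  shows "distinct (trace x)"
proof -
  have neq: "(collatz ^^ i) x \<noteq> (collatz ^^ j) x" if "i < j" "j < n" for i j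
  proof
    assume eq: "(collatz ^^ i) x = (collatz ^^ j) x"
    have "(collatz ^^ (n - j + i)) x = (collatz ^^ (n - j)) ((collatz ^^ i) x)"
      by (simp add: funpow_add)
    also have "\<dots> = (collatz ^^ (n - j + j)) x"
      unfolding eq by (simp add: funpow_add)
    also have "\<dots> = (collatz ^^ n) x"
      using that by simp
    finally have "(collatz ^^ (n - j + i)) x = (collatz ^^ n) x" .
    moreover have "n - j + i < n"
      using that by linarith
    ultimately show False
      using hits_imp_power_of_two[OF assms(1)] hits_not_power_of_two[OF assms(1)] by metis
  qed
  then show ?thesis
    unfolding distinct_conv_nth length_trace trace_length_eqI[OF assms]
    using trace_length_eqI[OF assms] by (metis nth_trace nat_neq_iff)
qed

section \<open>Ranks\<close>

definition ranks :: "nat list \<Rightarrow> nat list" where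
  "ranks xs = map (\<lambda>a. card {b \<in> set xs. b \<le> a}) xs"

lemma length_ranks [simp]: "length (ranks xs) = length xs"
  by (simp add: ranks_def)

lemma rank_less_iff:
  fixes A :: "nat set"
  assumes "finite A" "a \<in> A" "b \<in> A"
  shows "card {c \<in> A. c \<le> a} < card {c \<in> A. c \<le> b} \<longleftrightarrow> a < b"
proof
  assume "a < b"
  then have "{c \<in> A. c \<le> a} \<subseteq> {c \<in> A. c \<le> b}" "b \<in> {c \<in> A. c \<le> b} - {c \<in> A. c \<le> a}"
    using assms by auto
  then have "{c \<in> A. c \<le> a} \<subset> {c \<in> A. c \<le> b}"
    by blast
  then show "card {c \<in> A. c \<le> a} < card {c \<in> A. c \<le> b}"
    using assms by (intro psubset_card_mono) auto
next
  assume less: "card {c \<in> A. c \<le> a} < card {c \<in> A. c \<le> b}"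
  show "a < b"
  proof (rule ccontr)
    assume "\<not> a < b"
    then have "{c \<in> A. c \<le> b} \<subseteq> {c \<in> A. c \<le> a}"
      by auto
    then have "card {c \<in> A. c \<le> b} \<le> card {c \<in> A. c \<le> a}"
      using assms by (intro card_mono) auto
    with less show False
      by simp
  qed
qed

lemma ranks_less_iff:
  assumes "i < length xs" "j < length xs"
  shows "ranks xs ! i < ranks xs ! j \<longleftrightarrow> xs ! i < xs ! j"
  using assms by (simp add: ranks_def rank_less_iff)

lemma ranks_permutation:
  assumes "distinct xs"
  shows "ranks xs \<in> permutations_of_set {1..length xs}"
proof -
  let ?r = "\<lambda>a. card {b \<in> set xs. b \<le> a}"
  have inj: "inj_on ?r (set xs)"
    by (intro inj_onI) (metis List.finite_set rank_less_iff nat_neq_iff)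
  have sub: "?r ` set xs \<subseteq> {1..length xs}"
  proof safe
    fix a
    assume a: "a \<in> set xs"
    have "card {b \<in> set xs. b \<le> a} \<le> card (set xs)"
      by (intro card_mono) auto
    moreover have "card {b \<in> set xs. b \<le> a} > 0"
      using a by (auto simp: card_gt_0_iff)
    ultimately show "?r a \<in> {1..length xs}"
      using card_length[of xs] by simp
  qed
  have "card (?r ` set xs) = length xs"
    using inj assms by (simp add: card_image distinct_card)
  then have "?r ` set xs = {1..length xs}"
    using sub by (intro card_subset_eq) auto
  moreover have "distinct (ranks xs)"
    using inj assms by (simp add: ranks_def distinct_map)
  ultimately show ?thesis
    by (simp add: permutations_of_set_def ranks_def)
qed

text \<open>
  Distinctness turns the rank of an entry into the number of positions whose entries do not exceed
  it, and this number depends on the comparisons alone.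
\<close>

lemma ranks_eqI:
  assumes "distinct xs" "distinct ys" "length xs = length ys"
    and less: "\<And>i j. i < j \<Longrightarrow> j < length xs \<Longrightarrow> xs ! j < xs ! i \<longleftrightarrow> ys ! j < ys ! i"
  shows "ranks xs = ranks ys"
proof -
  have le: "xs ! k \<le> xs ! i \<longleftrightarrow> ys ! k \<le> ys ! i" if "k < length xs" "i < length xs" for i k
  proof (cases rule: linorder_cases[of i k])
    case less
    then have "xs ! k \<noteq> xs ! i" "ys ! k \<noteq> ys ! i"
      using that assms(1-3) by (auto simp: nth_eq_iff_index_eq)
    then show ?thesis
      using assms(4)[OF less] that by linarith
  next
    case greater
    then show ?thesis
      using assms(4)[OF greater] that by linarith
  qed simp
  have count: "card {b \<in> set zs. b \<le> a} = card {k. k < length zs \<and> zs ! k \<le> a}"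
    if "distinct zs" for zs :: "nat list" and a
  proof -
    have "{b \<in> set zs. b \<le> a} = (!) zs ` {k. k < length zs \<and> zs ! k \<le> a}"
      by (auto simp: in_set_conv_nth)
    moreover have "inj_on ((!) zs) {k. k < length zs \<and> zs ! k \<le> a}"
      using that by (auto simp: inj_on_def nth_eq_iff_index_eq)
    ultimately show ?thesis
      by (simp add: card_image)
  qed
  show ?thesis
  proof (rule nth_equalityI)
    fix i
    assume "i < length (ranks xs)"
    then have i: "i < length xs"
      by simp
    have "{k. k < length xs \<and> xs ! k \<le> xs ! i} = {k. k < length ys \<and> ys ! k \<le> ys ! i}"
      using le i assms(3) by auto
    then show "ranks xs ! i = ranks ys ! i"
      using i assms(1-3) by (simp add: ranks_def count)
  qed (simp add: assms)
qed

lemma collatz_permutation_eq_ranks: "collatz_permutation x = ranks (trace x)"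
  by (simp add: collatz_permutation_def ranks_def)

lemma collatz_permutations_eq_image:
  assumes "collatz_conjecture" "n \<ge> 1"
  shows "collatz_permutations n = collatz_permutation ` {x. hits x n}"
proof (intro equalityI subsetI)
  fix p
  assume p: "p \<in> collatz_permutations n"
  then obtain x where x: "x > 0" "\<not> power_of_two x" "p = collatz_permutation x"
    by (auto simp: collatz_permutations_def)
  have "length p = n"
    using p length_finite_permutations_of_set by (fastforce simp: collatz_permutations_def)
  then have "trace_length x = n"
    using x by (simp add: collatz_permutation_eq_ranks)
  then show "p \<in> collatz_permutation ` {x. hits x n}"
    using hits_trace_length[OF assms(1) x(1,2)] x(3) by auto
next
  fix p
  assume "p \<in> collatz_permutation ` {x. hits x n}"
  then obtain x where x: "hits x n" "p = collatz_permutation x"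
    by auto
  have "p \<in> permutations_of_set {1..n}"
    using ranks_permutation[OF distinct_trace[OF x(1) assms(2)]] trace_length_eqI[OF x(1) assms(2)] x(2)
    by (simp add: collatz_permutation_eq_ranks)
  moreover have "\<not> power_of_two x"
    using hits_not_power_of_two[OF x(1), of 0] assms(2) by simp
  ultimately show "p \<in> collatz_permutations n"
    using hits_pos[OF x(1)] x(2) by (auto simp: collatz_permutations_def)
qed

section \<open>Parity words\<close>

definition parity_word :: "nat \<Rightarrow> nat \<Rightarrow> bool list" where
  "parity_word x n = map (\<lambda>i. odd ((collatz ^^ i) x)) [0..<n]"

lemma parity_word_0 [simp]: "parity_word x 0 = []"
  by (simp add: parity_word_def)

lemma parity_word_Suc: "parity_word x (Suc n) = odd x # parity_word (collatz x) n"
  unfolding parity_word_def upt_conv_Cons[OF zero_less_Suc] map_Suc_upt[symmetric]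
  by (simp del: funpow.simps upt_Suc add: funpow_Suc_right comp_def)

lemma parity_word_eq_imp:
  "parity_word x n = parity_word y n \<Longrightarrow> i < n \<Longrightarrow>
    odd ((collatz ^^ i) x) = odd ((collatz ^^ i) y)"
  by (auto simp: parity_word_def)

text \<open>
  The words that end in an odd letter and contain no two adjacent odd letters.  The base case \<open>{}\<close>
  makes the recursion correct at length \<open>2\<close> too: it excludes the word odd-even.
\<close>

fun parity_words :: "nat \<Rightarrow> bool list set" where
  "parity_words 0 = {}"
| "parity_words (Suc 0) = {[True]}"
| "parity_words (Suc (Suc n)) =
    (#) False ` parity_words (Suc n) \<union> (\<lambda>w. True # False # w) ` parity_words n"

lemma finite_parity_words [simp]: "finite (parity_words n)"
  by (induction n rule: parity_words.induct) auto

lemma card_parity_words: "card (parity_words n) = fib n"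
proof (induction n rule: parity_words.induct)
  case (3 n)
  have "card (parity_words (Suc (Suc n))) =
      card ((#) False ` parity_words (Suc n)) + card ((\<lambda>w. True # False # w) ` parity_words n)"
    unfolding parity_words.simps by (rule card_Un_disjoint) auto
  also have "\<dots> = card (parity_words (Suc n)) + card (parity_words n)"
    by (simp add: card_image inj_on_def)
  finally show ?case
    using 3 by simp
qed auto

text \<open>
  If \<open>x\<close> is odd and not the last element, its successor is even and cannot be the last element
  either: half of it would be a power of two, hence so would be the successor itself.
\<close>

lemma parity_word_mem:
  "hits x n \<Longrightarrow> n \<ge> 1 \<Longrightarrow> parity_word x n \<in> parity_words n"
proof (induction n arbitrary: x rule: parity_words.induct)
  case 1
  then show ?case
    by simp
next
  case 2
  then have "odd x"
    by (auto simp: collatz_def elim!: evenE)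
  then show ?case
    by (simp add: parity_word_Suc)
next
  case (3 n)
  show ?case
  proof (cases "even x")
    case True
    then show ?thesis
      using 3(1)[of "collatz x"] 3(3) by (simp add: parity_word_Suc)
  next
    case False
    then have even: "even (collatz x)"
      by (simp add: collatz_def)
    have h: "\<not> power_of_two (collatz x)" "hits (collatz (collatz x)) n"
      using 3(3) by auto
    from even have "\<not> power_of_two (collatz (collatz x))"
      using h(1) by (auto simp: collatz_def[of "collatz x"] elim!: evenE)
    then have "n \<ge> 1"
      using h(2) by (cases n) auto
    then show ?thesis
      using 3(2)[OF h(2)] False even by (simp add: parity_word_Suc)
  qed
qed

section \<open>Every word is the parity word of arbitrarily large numbers\<close>

text \<open>
  The number \<open>(4 ^ m - 1) / 3\<close>, whose base-4 digits are all \<open>1\<close>.  For \<open>m \<ge> 2\<close> these are the possible last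
  elements of a trace.
\<close>

definition repunit4 :: "nat \<Rightarrow> nat" where
  "repunit4 m = (\<Sum>i<m. 4 ^ i)"

lemma repunit4_Suc: "repunit4 (Suc m) = 4 * repunit4 m + 1"
  unfolding repunit4_def sum.lessThan_Suc_shift by (simp add: sum_distrib_left)

lemma power4_eq: "4 ^ m = 3 * repunit4 m + 1"
  by (induction m) (simp_all add: repunit4_Suc, simp add: repunit4_def)

lemma repunit4_add: "repunit4 (m + k) = 4 ^ m * repunit4 k + repunit4 m"
  by (induction m) (simp_all add: repunit4_Suc, simp add: repunit4_def)

lemma repunit4_ge: "m \<le> repunit4 m"
  by (induction m) (simp_all add: repunit4_Suc)

text \<open>
  The 3-adic valuation of \<open>repunit4 (3 ^ a)\<close> is exactly \<open>a\<close>.  Tripling the index multiplies the value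
  \<open>s\<close> by \<open>1 + q + q ^ 2\<close> with \<open>q = 4 ^ (3 ^ a) = 3 * s + 1\<close>, which is \<open>3\<close> times a number congruent to \<open>1\<close>
  modulo \<open>3\<close>.
\<close>

lemma repunit4_power3: "\<exists>t. repunit4 (3 ^ a) = 3 ^ a * (3 * t + 1)"
proof (induction a)
  case 0
  show ?case
    by (rule exI[of _ 0]) (simp add: repunit4_def)
next
  case (Suc a)
  then obtain t where t: "repunit4 (3 ^ a) = 3 ^ a * (3 * t + 1)"
    by blast
  define s where "s = repunit4 (3 ^ a)"
  have "repunit4 (3 ^ Suc a) = repunit4 (3 ^ a + (3 ^ a + 3 ^ a))"
    by (simp add: numeral_3_eq_3)
  also have "\<dots> = s * (3 * (3 * s ^ 2 + 3 * s + 1))"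
    unfolding repunit4_add power4_eq s_def[symmetric]
    by (simp add: algebra_simps power2_eq_square)
  also have "\<dots> = 3 ^ Suc a * ((3 * t + 1) * (3 * (s ^ 2 + s) + 1))"
    by (subst (1) t[folded s_def]) (simp add: algebra_simps)
  also have "(3 * t + 1) * (3 * (s ^ 2 + s) + 1) = 3 * (t * (3 * (s ^ 2 + s) + 1) + s ^ 2 + s) + 1"
    by (simp add: algebra_simps)
  finally show ?case
    by blast
qed

text \<open>
  Modulo \<open>3 ^ Suc a\<close>, raising the index by \<open>3 ^ a\<close> raises the value by \<open>3 ^ a\<close>.  An index that is right modulo
  \<open>3 ^ a\<close> can therefore be corrected to one that is right modulo \<open>3 ^ Suc a\<close>, by at most two such
  raises.
\<close>

lemma repunit4_residue: "\<exists>m>B. [repunit4 m = r] (mod 3 ^ a)"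
proof (induction a)
  case 0
  show ?case
    by (rule exI[of _ "Suc B"]) simp
next
  case (Suc a)
  then obtain m where m: "m > B" "[repunit4 m = r] (mod 3 ^ a)"
    by blast
  obtain t where t: "repunit4 (3 ^ a) = 3 ^ a * (3 * t + 1)"
    using repunit4_power3 by blast
  have step: "[repunit4 (3 ^ a * j + k) = 3 ^ a * j + repunit4 k] (mod 3 ^ Suc a)" for j k
  proof (induction j)
    case (Suc j)
    let ?n = "3 ^ a * j + k"
    have "repunit4 (3 ^ a * Suc j + k) = repunit4 (?n + 3 ^ a)"
      by (simp add: algebra_simps)
    also have "\<dots> = (3 * repunit4 ?n + 1) * (3 ^ a * (3 * t + 1)) + repunit4 ?n"
      by (simp add: repunit4_add power4_eq t)
    also have "\<dots> = 3 ^ Suc a * (repunit4 ?n * (3 * t + 1) + t) + (3 ^ a + repunit4 ?n)"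
      by (simp add: algebra_simps)
    also have "[\<dots> = 3 ^ a + repunit4 ?n] (mod 3 ^ Suc a)"
      by (simp add: cong_def)
    also have "[3 ^ a + repunit4 ?n = 3 ^ a + (3 ^ a * j + repunit4 k)] (mod 3 ^ Suc a)"
      using Suc by (intro cong_add) auto
    finally show ?case
      by (simp add: algebra_simps)
  qed simp
  have "[int (repunit4 m) = int r] (mod 3 ^ a)"
    using m(2) cong_int_iff[of "repunit4 m" r "3 ^ a"] by simp
  then obtain d where d: "int r = int (repunit4 m) + 3 ^ a * d"
    by (metis cong_iff_lin)
  define j where "j = nat (d mod 3)"
  have "int j = d mod 3"
    by (simp add: j_def)
  then have "[int (3 ^ a * j + repunit4 m) = int r] (mod 3 ^ Suc a)"
    unfolding d by (simp add: cong_def)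
      (metis (no_types, opaque_lifting) add.commute mod_add_left_eq mod_mult_mult1 mult.commute)
  then have "[3 ^ a * j + repunit4 m = r] (mod 3 ^ Suc a)"
    using cong_int_iff[of "3 ^ a * j + repunit4 m" r "3 ^ Suc a"] by simp
  with step[of j m] have "[repunit4 (3 ^ a * j + m) = r] (mod 3 ^ Suc a)"
    using cong_trans by blast
  moreover have "3 ^ a * j + m > B"
    using m(1) by simp
  ultimately show ?case
    by blast
qed

text \<open>
  Prescribing the residue modulo every power of \<open>3\<close> makes the induction work.  Undoing a halving
  doubles the number, and doubling permutes the residues modulo \<open>3 ^ a\<close>.  Undoing an upward step maps \<open>y\<close> to
  \<open>(y - 1) / 3\<close>; that this is an integer with residue \<open>r\<close> modulo \<open>3 ^ a\<close> is a condition on the residue of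
  \<open>y\<close> modulo \<open>3 ^ Suc a\<close>.
\<close>

lemma exists_large_parity_word:
  "w \<in> parity_words n \<Longrightarrow>
    \<exists>x>B. [x = r] (mod 3 ^ a) \<and> hits x n \<and> parity_word x n = w"
proof (induction n arbitrary: w B r a rule: parity_words.induct)
  case 1
  then show ?case
    by simp
next
  case 2
  obtain m where m: "m > Suc B" "[repunit4 m = r] (mod 3 ^ a)"
    using repunit4_residue by blast
  then obtain k where k: "m = Suc k"
    by (cases m) auto
  have gt: "repunit4 m > Suc B"
    using m(1) repunit4_ge[of m] by simp
  have odd: "odd (repunit4 m)"
    unfolding k repunit4_Suc by simp
  have "\<not> power_of_two (repunit4 m)"
    using odd_power_of_two[OF odd] gt by auto
  moreover have "collatz (repunit4 m) = 2 ^ (2 * m)"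
    using odd by (simp add: collatz_def power_mult power4_eq)
  ultimately have "hits (repunit4 m) (Suc 0)"
    by (auto simp: power_of_two_def)
  then show ?case
    using gt odd m(2) 2 by (intro exI[of _ "repunit4 m"]) (auto simp: parity_word_Suc)
next
  case (3 n)
  consider (F) v where "v \<in> parity_words (Suc n)" "w = False # v"
    | (T) v where "v \<in> parity_words n" "w = True # False # v"
    using 3(3) by auto
  then show ?case
  proof cases
    case F
    \<comment> \<open>\<open>h\<close> is the inverse of \<open>2\<close> modulo \<open>3 ^ a\<close>.\<close>
    obtain h :: nat where h: "3 ^ a + 1 = 2 * h"
      using evenE[of "3 ^ a + 1 :: nat"] by auto
    obtain x where x: "x > B" "[x = r * h] (mod 3 ^ a)" "hits x (Suc n)" "parity_word x (Suc n) = v"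
      using 3(1)[OF F(1)] by metis
    have "[2 * x = 2 * (r * h)] (mod 3 ^ a)"
      using x(2) by (intro cong_mult) auto
    also have "2 * (r * h) = r * 3 ^ a + r"
      using h by (metis distrib_left mult.left_commute mult.right_neutral)
    also have "[r * 3 ^ a + r = r] (mod 3 ^ a)"
      by (simp add: cong_def)
    finally have "[2 * x = r] (mod 3 ^ a)" .
    moreover have c: "collatz (2 * x) = x"
      by (simp add: collatz_def)
    moreover have "hits (2 * x) (Suc (Suc n))"
      unfolding hits.simps(2)[of "2 * x"] c using x(3) by simp
    moreover have "parity_word (2 * x) (Suc (Suc n)) = w"
      unfolding parity_word_Suc[of "2 * x"] c using x(4) F(2) by simp
    ultimately show ?thesis
      using x(1) by (intro exI[of _ "2 * x"]) auto
  next
    case T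
    \<comment> \<open>An upward step must be followed by a halving, so both are undone at once:
      \<open>2 * z = 3 * x + 1\<close> is even, which makes \<open>x\<close> odd.\<close>
    obtain h :: nat where h: "3 ^ Suc a + 1 = 2 * h"
      using evenE[of "3 ^ Suc a + 1 :: nat"] by auto
    obtain z where z: "z > 3 * B + 1" "[z = (3 * r + 1) * h] (mod 3 ^ Suc a)" "hits z n"
        "parity_word z n = v"
      using 3(2)[OF T(1)] by metis
    have "n \<noteq> 0"
      using T(1) by (cases n) auto
    have "[2 * z = 2 * ((3 * r + 1) * h)] (mod 3 ^ Suc a)"
      using z(2) by (intro cong_mult) auto
    also have "2 * ((3 * r + 1) * h) = (3 * r + 1) * 3 ^ Suc a + (3 * r + 1)"
      using h by (metis distrib_left mult.left_commute mult.right_neutral)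
    also have "[(3 * r + 1) * 3 ^ Suc a + (3 * r + 1) = 3 * r + 1] (mod 3 ^ Suc a)"
      unfolding cong_def by (rule mod_mult_self3)
    finally have cong: "[2 * z = 3 * r + 1] (mod 3 ^ Suc a)" .
    then have "[2 * z = 3 * r + 1] (mod 3)"
      by (rule cong_dvd_modulus_nat) simp
    then have "(2 * z) mod 3 = 1"
      by (simp add: cong_def)
    then obtain x where x: "2 * z = 3 * x + 1"
      by (metis mult_div_mod_eq)
    have "[3 * x = 3 * r] (mod 3 * 3 ^ a)"
      using cong unfolding x cong_add_rcancel_nat by simp
    then have congx: "[x = r] (mod 3 ^ a)"
      by (simp add: cong_def mod_mult_mult1)
    have "even (3 * x + 1)"
      unfolding x[symmetric] by simp
    then have odd: "odd x"
      by simp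
    have c: "collatz x = 2 * z"
      using odd x by (simp add: collatz_def)
    have cc: "collatz (2 * z) = z"
      by (simp add: collatz_def)
    have nz: "\<not> power_of_two z"
      using z(3) \<open>n \<noteq> 0\<close> by (cases n) auto
    then have "\<not> power_of_two x"
      using power_of_two_collatz[of x] c by auto
    then have "hits x (Suc (Suc n))"
      using nz z(3) by (simp add: c cc)
    moreover have "parity_word x (Suc (Suc n)) = w"
      using z(4) T(2) odd by (simp add: parity_word_Suc c cc)
    moreover have "x > B"
      using x z(1) by linarith
    ultimately show ?thesis
      using congx by blast
  qed
qed

lemma parity_words_eq_image:
  assumes "n \<ge> 1"
  shows "parity_words n = (\<lambda>x. parity_word x n) ` {x. hits x n}"
proof (intro equalityI subsetI)
  fix w
  assume "w \<in> parity_words n"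
  then obtain x where "hits x n" "parity_word x n = w"
    using exists_large_parity_word[of w n 0 0 0] by blast
  then show "w \<in> (\<lambda>x. parity_word x n) ` {x. hits x n}"
    by blast
next
  fix w
  assume "w \<in> (\<lambda>x. parity_word x n) ` {x. hits x n}"
  then show "w \<in> parity_words n"
    using parity_word_mem assms by blast
qed

section \<open>The permutation determines the parity word\<close>

text \<open>
  The last position, which has no successor, counts as an ascent; this matches the last element of
  a trace being odd.
\<close>

definition ascents :: "nat list \<Rightarrow> bool list" where
  "ascents p = map (\<lambda>i. Suc i < length p \<longrightarrow> p ! i < p ! Suc i) [0..<length p]"

lemma collatz_less_iff: "x > 0 \<Longrightarrow> x < collatz x \<longleftrightarrow> odd x"
  by (auto simp: collatz_def)

lemma ascents_collatz_permutation:
  assumes "hits x n" "n \<ge> 1"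
  shows "ascents (collatz_permutation x) = parity_word x n"
proof (rule nth_equalityI)
  have len: "trace_length x = n"
    using assms trace_length_eqI by blast
  then show "length (ascents (collatz_permutation x)) = length (parity_word x n)"
    by (simp add: ascents_def parity_word_def collatz_permutation_eq_ranks)
  fix i
  assume "i < length (ascents (collatz_permutation x))"
  then have i: "i < n"
    using len by (simp add: ascents_def collatz_permutation_eq_ranks)
  let ?y = "(collatz ^^ i) x"
  have hy: "hits ?y (n - i)"
    using hits_funpow[OF assms(1)] i by simp
  have "(Suc i < n \<longrightarrow> ?y < collatz ?y) \<longleftrightarrow> odd ?y"
  proof (cases "Suc i < n")
    case True
    then show ?thesis
      using collatz_less_iff[OF hits_pos[OF hy]] by simp
  next
    case False
    then have "n - i = Suc 0"
      using i by simp
    then have "parity_word ?y (Suc 0) \<in> parity_words (Suc 0)"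
      using parity_word_mem[OF hy] by simp
    then show ?thesis
      using False by (simp add: parity_word_Suc)
  qed
  then show "ascents (collatz_permutation x) ! i = parity_word x n ! i"
    using i len
    by (simp add: ascents_def parity_word_def collatz_permutation_eq_ranks ranks_less_iff nth_trace)
qed

lemma ascents_image_collatz_permutations:
  assumes "collatz_conjecture" "n \<ge> 1"
  shows "ascents ` collatz_permutations n = parity_words n"
  unfolding collatz_permutations_eq_image[OF assms] parity_words_eq_image[OF assms(2)] image_image
  using ascents_collatz_permutation[OF _ assms(2)] by (intro image_cong) auto

section \<open>Comparing two elements of a trace\<close>

definition ups :: "nat \<Rightarrow> nat \<Rightarrow> nat" where
  "ups x l = (\<Sum>i<l. of_bool (odd ((collatz ^^ i) x)))"

definition downs :: "nat \<Rightarrow> nat \<Rightarrow> nat" where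
  "downs x l = (\<Sum>i<l. of_bool (even ((collatz ^^ i) x)))"

lemma ups_0 [simp]: "ups x 0 = 0" and downs_0 [simp]: "downs x 0 = 0"
  by (simp_all add: ups_def downs_def)

lemma ups_Suc: "ups x (Suc l) = ups x l + of_bool (odd ((collatz ^^ l) x))"
  and downs_Suc: "downs x (Suc l) = downs x l + of_bool (even ((collatz ^^ l) x))"
  by (simp_all add: ups_def downs_def)

lemma ups_add_downs: "ups x l + downs x l = l"
  by (induction l) (auto simp: ups_Suc downs_Suc)

lemma ups_downs_cong:
  assumes "parity_word x n = parity_word y n" "i + l \<le> n"
  shows "ups ((collatz ^^ i) x) l = ups ((collatz ^^ i) y) l"
    and "downs ((collatz ^^ i) x) l = downs ((collatz ^^ i) y) l"
proof -
  have "odd ((collatz ^^ k) ((collatz ^^ i) x)) = odd ((collatz ^^ k) ((collatz ^^ i) y))"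
    if "k < l" for k
    using parity_word_eq_imp[OF assms(1), of "k + i"] that assms(2) by (simp add: funpow_add)
  then show "ups ((collatz ^^ i) x) l = ups ((collatz ^^ i) y) l"
    and "downs ((collatz ^^ i) x) l = downs ((collatz ^^ i) y) l"
    by (auto simp: ups_def downs_def intro!: sum.cong)
qed

lemma funpow_collatz_lower:
  "3 ^ ups x l * x \<le> 2 ^ downs x l * (collatz ^^ l) x"
proof (induction l)
  case (Suc l)
  show ?case
  proof (cases "even ((collatz ^^ l) x)")
    case True
    then have "(collatz ^^ l) x = 2 * collatz ((collatz ^^ l) x)"
      by (simp add: collatz_def)
    then have "3 ^ ups x l * x \<le> 2 ^ downs x l * (2 * collatz ((collatz ^^ l) x))"
      using Suc by metis
    then show ?thesis
      using True by (simp add: ups_Suc downs_Suc mult_ac)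
  next
    case False
    then have "3 * (collatz ^^ l) x \<le> collatz ((collatz ^^ l) x)"
      by (simp add: collatz_def)
    then have mono: "2 ^ downs x l * (3 * (collatz ^^ l) x)
        \<le> 2 ^ downs x l * collatz ((collatz ^^ l) x)"
      by (rule mult_le_mono2)
    have "3 ^ ups x (Suc l) * x = 3 * (3 ^ ups x l * x)"
      using False by (simp add: ups_Suc)
    also have "\<dots> \<le> 3 * (2 ^ downs x l * (collatz ^^ l) x)"
      using Suc by (rule mult_le_mono2)
    also have "\<dots> = 2 ^ downs x l * (3 * (collatz ^^ l) x)"
      by (rule mult.left_commute)
    also note mono
    finally show ?thesis
      using False by (simp add: downs_Suc)
  qed
qed simp

text \<open>
  Both forms of the bound are needed for the induction.  A halving turns the weak form with \<open>k = 2\<close>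
  into the strong one with \<open>k = 1\<close>.  An upward step turns the strong form into the weak one,
  since \<open>(3 * z + 1) + 2 = 3 * (z + 1)\<close>; it starts from an odd \<open>z\<close>, for which the strong form holds, and
  its result is even.
\<close>

lemma funpow_collatz_upper:
  fixes x l :: nat
  defines "z \<equiv> (collatz ^^ l) x"
  defines "k \<equiv> if odd z then 1 else 2"
  shows "2 ^ l * (z + k) \<le> 3 ^ ups x l * (2 ^ ups x l * x + k * 2 ^ downs x l)"
  unfolding k_def z_def
proof (induction l)
  case (Suc l)
  define z a b where "z = (collatz ^^ l) x" and "a = ups x l" and "b = downs x l"
  have IH: "2 ^ l * (z + (if odd z then 1 else 2)) \<le> 3 ^ a * (2 ^ a * x + (if odd z then 1 else 2) * 2 ^ b)"
    using Suc unfolding z_def a_def b_def .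
  have l: "(2::nat) ^ l = 2 ^ a * 2 ^ b"
    unfolding a_def b_def by (simp flip: power_add add: ups_add_downs)
  show ?case
  proof (cases "even z")
    case True
    then obtain z' where z': "z = 2 * z'"
      by (elim evenE)
    have strong: "2 ^ l * (2 * z' + 2) \<le> 3 ^ a * (2 ^ a * x + 2 * 2 ^ b)"
      using IH z' by simp
    have "(2::nat) ^ a * 2 ^ b \<le> 3 ^ a * 2 ^ b"
      by (intro mult_le_mono1 power_mono) auto
    then have "(2::nat) ^ l * 2 \<le> 3 ^ a * (2 * 2 ^ b)"
      unfolding l by simp
    with strong have weak: "2 ^ l * (2 * z' + 4) \<le> 3 ^ a * (2 ^ a * x + 4 * 2 ^ b)"
      by (simp add: algebra_simps)
    have "collatz z = z'" "ups x (Suc l) = a" "downs x (Suc l) = Suc b"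
      using True z' by (simp_all add: collatz_def ups_Suc downs_Suc a_def b_def z_def)
    then show ?thesis
      using strong weak by (simp flip: z_def) (simp add: algebra_simps)
  next
    case False
    have "collatz z = 3 * z + 1" "ups x (Suc l) = Suc a" "downs x (Suc l) = b"
      using False by (simp_all add: collatz_def ups_Suc downs_Suc a_def b_def z_def)
    then show ?thesis
      using IH False by (simp flip: z_def) (simp add: algebra_simps)
  qed
qed simp

text \<open>
  If \<open>y\<close> is not larger than the end \<open>z\<close> of its run, the upper bound on \<open>z\<close> becomes an upper bound
  on \<open>y\<close>.  It is large only if \<open>3 ^ a / 2 ^ b\<close> is just below \<open>1\<close>, and among the runs of at most
  \<open>13\<close> steps the worst slope by far is \<open>3 ^ 5 / 2 ^ 8 = 243 / 256\<close>, attained with exactly \<open>13\<close>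
  steps.
\<close>

lemma anomaly_bound:
  fixes y a b k :: nat
  assumes upper: "2 ^ (a + b) * (y + k) \<le> 3 ^ a * (2 ^ a * y + k * 2 ^ b)"
    and slope: "(3::nat) ^ a < 2 ^ b" and len: "a + b \<le> 13"
    and k: "k = 1 \<or> k = 2"
  shows "y < 130 * k \<and> (a + b < 13 \<longrightarrow> y \<le> 30)"
proof -
  have "a \<le> 5"
  proof (rule ccontr)
    assume "\<not> a \<le> 5"
    then have "(3::nat) ^ 6 \<le> 3 ^ a" "(2::nat) ^ b \<le> 2 ^ 7"
      using len by (intro power_increasing; simp)+
    then show False
      using slope by simp
  qed
  then have "a = 0 \<or> a = 1 \<or> a = 2 \<or> a = 3 \<or> a = 4 \<or> a = 5"
    by arith
  moreover have "b = 0 \<or> b = 1 \<or> b = 2 \<or> b = 3 \<or> b = 4 \<or> b = 5 \<or> b = 6 \<or> b = 7 \<or> b = 8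
      \<or> b = 9 \<or> b = 10 \<or> b = 11 \<or> b = 12 \<or> b = 13"
    using len by arith
  ultimately show ?thesis
    using upper slope len k by (elim disjE; simp)
qed

lemma anomaly_small:
  assumes "3 ^ ups y l < (2::nat) ^ downs y l" "l \<le> 13" "y \<le> (collatz ^^ l) y"
  shows "y < 260"
    and "odd ((collatz ^^ l) y) \<Longrightarrow> y < 130"
    and "l < 13 \<Longrightarrow> y \<le> 30"
proof -
  let ?a = "ups y l" and ?b = "downs y l"
  define k :: nat where "k = (if odd ((collatz ^^ l) y) then 1 else 2)"
  have "2 ^ (?a + ?b) * (y + k) \<le> 2 ^ l * ((collatz ^^ l) y + k)"
    using assms(3) by (simp add: ups_add_downs)
  also have "\<dots> \<le> 3 ^ ?a * (2 ^ ?a * y + k * 2 ^ ?b)"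
    unfolding k_def by (rule funpow_collatz_upper)
  finally have "y < 130 * k \<and> (?a + ?b < 13 \<longrightarrow> y \<le> 30)"
    using assms(1,2) by (intro anomaly_bound) (auto simp: ups_add_downs k_def)
  then show "y < 260" "odd ((collatz ^^ l) y) \<Longrightarrow> y < 130" "l < 13 \<Longrightarrow> y \<le> 30"
    by (auto simp: ups_add_downs k_def split: if_splits)
qed

text \<open>
  The Collatz map together with the numerator and the denominator of the slope, in a form that the
  simplifier can run.
\<close>

fun slope_step :: "nat \<times> nat \<times> nat \<Rightarrow> nat \<times> nat \<times> nat" where
  "slope_step (z, s, t) = (if even z then (z div 2, s, 2 * t) else (3 * z + 1, 3 * s, t))"

lemma funpow_slope_step:
  "(slope_step ^^ l) (y, 1, 1) = ((collatz ^^ l) y, 3 ^ ups y l, 2 ^ downs y l)"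
  by (induction l) (simp_all add: ups_Suc downs_Suc collatz_def[of "(collatz ^^ l) y" for l])

lemma funpow_numeral: "(f ^^ numeral k) x = (f ^^ pred_numeral k) (f x)"
  by (simp add: numeral_eq_Suc funpow_swap1)

text \<open>
  Odd ends suffice for runs of \<open>13\<close> steps, since such a run in a trace of length \<open>14\<close> stops at the last
  element.  Even ends must be exempted: \<open>9\<close> leads to \<open>10\<close>.
\<close>

lemma check_13_steps: "list_all (\<lambda>y. case (slope_step ^^ 13) (y, 1, 1) of
    (z, s, t) \<Rightarrow> even z \<or> t \<le> s \<or> z < y) [2..<130]"
  by (simp add: funpow_numeral)

text \<open>
  Anomalies such as the run of \<open>8\<close> steps from \<open>3\<close> to \<open>4\<close> exist, but they stop at a power of two and so
  do not lie within a trace.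
\<close>

lemma check_12_steps: "list_all (\<lambda>y. list_all (\<lambda>l. case (slope_step ^^ l) (y, 1, 1) of
    (z, s, t) \<Rightarrow> z \<in> {1, 2, 4, 8} \<or> t \<le> s \<or> z < y) [0..<13]) [2..<31]"
  by (simp add: funpow_numeral upt_rec[of 0] upt_rec[of "Suc 0"] flip: numeral_2_eq_2)

text \<open>
  A trace of length at most \<open>14\<close> contains no anomaly that starts at its first element.  As the trace
  from any later element on is again a trace, this covers all pairs of elements.
\<close>

lemma less_iff_slope:
  assumes "hits y n" "n \<le> 14" "l < n"
  shows "(collatz ^^ l) y < y \<longleftrightarrow> (3::nat) ^ ups y l < 2 ^ downs y l"
proof
  assume "(collatz ^^ l) y < y"
  then have "2 ^ downs y l * (collatz ^^ l) y < 2 ^ downs y l * y"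
    by simp
  with funpow_collatz_lower[of y l] have "3 ^ ups y l * y < 2 ^ downs y l * y"
    by (rule le_less_trans)
  then show "(3::nat) ^ ups y l < 2 ^ downs y l"
    by simp
next
  assume slope: "(3::nat) ^ ups y l < 2 ^ downs y l"
  have npow: "\<not> power_of_two ((collatz ^^ l) y)" "\<not> power_of_two y"
    using hits_not_power_of_two[OF assms(1), of l] hits_not_power_of_two[OF assms(1), of 0] assms(3)
    by auto
  have pow: "power_of_two z" if "z \<in> {1, 2, 4, 8}" for z
  proof -
    have "z = 2 ^ 0 \<or> z = 2 ^ 1 \<or> z = 2 ^ 2 \<or> z = 2 ^ 3"
      using that by auto
    then show ?thesis
      unfolding power_of_two_def by blast
  qed
  have "y \<noteq> 1"
    using npow(2) pow[of 1] by auto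
  then have "y \<ge> 2"
    using hits_pos[OF assms(1)] by linarith
  show "(collatz ^^ l) y < y"
  proof (rule ccontr)
    assume "\<not> (collatz ^^ l) y < y"
    then have le: "y \<le> (collatz ^^ l) y"
      by simp
    have l: "l \<le> 13"
      using assms by simp
    show False
    proof (cases "l < 13")
      case True
      then have "y \<in> set [2..<31]" "l \<in> set [0..<13]"
        using anomaly_small(3)[OF slope l le] \<open>y \<ge> 2\<close> True
        unfolding set_upt atLeastLessThan_iff by simp_all
      then have "(collatz ^^ l) y \<in> {1, 2, 4, 8} \<or> 2 ^ downs y l \<le> (3::nat) ^ ups y l \<or> (collatz ^^ l) y < y"
        using check_12_steps unfolding list_all_iff funpow_slope_step split_conv by blast
      then show False
        using npow(1) pow slope le by auto
    next
      case False
      then have l13: "l = 13" "n - 13 = Suc 0"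
        using assms(2,3) by auto
      then have "hits ((collatz ^^ 13) y) (Suc 0)"
        using hits_funpow[OF assms(1), of 13] assms(3) by simp
      then have odd: "odd ((collatz ^^ 13) y)"
        using parity_word_mem[of "(collatz ^^ 13) y" "Suc 0"] by (simp add: parity_word_Suc)
      then have "y \<in> set [2..<130]"
        using anomaly_small(2)[OF slope l le] l13 \<open>y \<ge> 2\<close>
        unfolding set_upt atLeastLessThan_iff by simp
      then have "even ((collatz ^^ 13) y) \<or> 2 ^ downs y 13 \<le> (3::nat) ^ ups y 13 \<or> (collatz ^^ 13) y < y"
        using check_13_steps unfolding list_all_iff funpow_slope_step split_conv by blast
      then show False
        using odd slope le l13 by simp
    qed
  qed
qed

section \<open>Counting\<close>

lemma collatz_permutation_eqI:
  assumes "hits x n" "hits y n" "1 \<le> n" "n \<le> 14" "parity_word x n = parity_word y n"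
  shows "collatz_permutation x = collatz_permutation y"
  unfolding collatz_permutation_eq_ranks
proof (rule ranks_eqI)
  have len: "trace_length x = n" "trace_length y = n"
    using assms trace_length_eqI by blast+
  show "distinct (trace x)" "distinct (trace y)" "length (trace x) = length (trace y)"
    using assms distinct_trace len by auto
  fix i j
  assume ij: "i < j" "j < length (trace x)"
  have "(collatz ^^ j) v < (collatz ^^ i) v \<longleftrightarrow>
      (3::nat) ^ ups ((collatz ^^ i) v) (j - i) < 2 ^ downs ((collatz ^^ i) v) (j - i)"
    if "hits v n" for v
  proof -
    have "(collatz ^^ (j - i)) ((collatz ^^ i) v) = (collatz ^^ j) v"
      using ij by (simp flip: funpow_add[THEN fun_cong, unfolded comp_def])
    then show ?thesis
      using less_iff_slope[OF hits_funpow[OF that, of i], of "j - i"] ij len assms(4) by simp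
  qed
  from this[OF assms(1)] this[OF assms(2)]
  show "trace x ! j < trace x ! i \<longleftrightarrow> trace y ! j < trace y ! i"
    using ups_downs_cong[OF assms(5), of i "j - i"] ij len by (simp add: nth_trace)
qed

lemma funpow_collatz_double: "(collatz ^^ k) (2 ^ k * x) = x"
  by (induction k) (simp_all del: funpow.simps add: funpow_Suc_right collatz_def mult.assoc)

lemma hits_double: "n \<ge> 1 \<Longrightarrow> hits x n \<Longrightarrow> hits (2 ^ k * x) (n + k)"
proof (induction k)
  case (Suc k)
  then have "hits (2 ^ k * x) (n + k)" "n + k > 0"
    by auto
  then have "\<not> power_of_two (2 ^ k * x)"
    by (cases "n + k") auto
  with \<open>hits (2 ^ k * x) (n + k)\<close> show ?case
    by (simp add: collatz_def mult.assoc)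
qed simp

lemma funpow_collatz_ge: "x \<le> 2 ^ l * (collatz ^^ l) x"
proof (induction l)
  case (Suc l)
  have "(collatz ^^ l) x \<le> 2 * collatz ((collatz ^^ l) x)"
    by (simp add: collatz_def)
  then have "2 ^ l * (collatz ^^ l) x \<le> 2 ^ l * (2 * collatz ((collatz ^^ l) x))"
    by (rule mult_le_mono2)
  with Suc have "x \<le> 2 ^ l * (2 * collatz ((collatz ^^ l) x))"
    by (rule le_trans)
  then show ?case
    by (simp add: mult_ac)
qed simp

lemma hits_numeral:
  "hits x (numeral m) \<longleftrightarrow> \<not> power_of_two x \<and> hits (collatz x) (pred_numeral m)"
  by (simp add: numeral_eq_Suc)

lemma hits_9: "hits 9 15"
proof -
  have "\<not> power_of_two x" if "odd x" "x > 1" for x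
    using odd_power_of_two[OF that(1)] that(2) by auto
  then have odd: "\<not> power_of_two 9" "\<not> power_of_two 7" "\<not> power_of_two 11" "\<not> power_of_two 17"
    "\<not> power_of_two 13" "\<not> power_of_two 5"
    by simp_all
  have dbl: "power_of_two 28 \<longleftrightarrow> power_of_two 14" "power_of_two 14 \<longleftrightarrow> power_of_two 7" 
    "power_of_two 22 \<longleftrightarrow> power_of_two 11" "power_of_two 34 \<longleftrightarrow> power_of_two 17"
    "power_of_two 52 \<longleftrightarrow> power_of_two 26" "power_of_two 26 \<longleftrightarrow> power_of_two 13"
    "power_of_two 40 \<longleftrightarrow> power_of_two 20" "power_of_two 20 \<longleftrightarrow> power_of_two 10" 
    "power_of_two 10 \<longleftrightarrow> power_of_two 5"
    using power_of_two_double[of 14] power_of_two_double[of 7] power_of_two_double[of 11]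
      power_of_two_double[of 17] power_of_two_double[of 26] power_of_two_double[of 13]
      power_of_two_double[of 20] power_of_two_double[of 10] power_of_two_double[of 5]
    by (simp_all del: power_of_two_double)
  have "power_of_two 16"
    unfolding power_of_two_def by (rule exI[of _ 4]) simp
  then show ?thesis
    using odd dbl by (simp add: hits_numeral collatz_def)
qed

lemma not_inj_on_ascents:
  assumes "collatz_conjecture" "n \<ge> 15"
  shows "\<not> inj_on ascents (collatz_permutations n)"
proof
  assume inj: "inj_on ascents (collatz_permutations n)"
  \<comment> \<open>The position of \<open>9\<close> in the trace of \<open>2 ^ k * 9\<close>.\<close>
  define k where "k = n - 15"
  have n: "n = 15 + k" "n \<ge> 1"
    using assms(2) by (simp_all add: k_def)
  define x where "x = 2 ^ k * (9::nat)"
  have hx: "hits x n"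
    unfolding x_def n using hits_double[OF _ hits_9] by simp
  \<comment> \<open>At most \<open>k\<close> halvings leave an element above \<open>260\<close>, too large for an anomaly within \<open>13\<close> steps.\<close>
  obtain y where y: "y > 2 ^ k * 260" "hits y n" "parity_word y n = parity_word x n"
    using exists_large_parity_word[OF parity_word_mem[OF hx n(2)], of "2 ^ k * 260" 0 0] by blast
  have mem: "collatz_permutation x \<in> collatz_permutations n" "collatz_permutation y \<in> collatz_permutations n"
    using hx y(2) collatz_permutations_eq_image[OF assms(1) n(2)] by auto
  have eq: "collatz_permutation x = collatz_permutation y"
    using inj_onD[OF inj _ mem] y(3) hx y(2) n(2) by (simp add: ascents_collatz_permutation)
  have len: "trace_length x = n" "trace_length y = n"
    using hx y(2) n(2) trace_length_eqI by blast+
  have "trace x ! k < trace x ! (k + 13) \<longleftrightarrow> trace y ! k < trace y ! (k + 13)"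
    using arg_cong[OF eq, of "\<lambda>p. p ! k < p ! (k + 13)"] n len
    by (simp add: collatz_permutation_eq_ranks ranks_less_iff)
  then have iff: "(collatz ^^ k) x < (collatz ^^ 13) ((collatz ^^ k) x) \<longleftrightarrow>
      (collatz ^^ k) y < (collatz ^^ 13) ((collatz ^^ k) y)"
    using n len by (simp add: nth_trace funpow_add add.commute[of k 13])
  define z where "z = (collatz ^^ k) y"
  have xk: "(collatz ^^ k) x = 9"
    by (simp add: x_def funpow_collatz_double)
  have nine: "(slope_step ^^ 13) (9, 1, 1) = (10, 3 ^ 5, 2 ^ 8)"
    by (simp add: funpow_numeral)
  then have "(collatz ^^ 13) 9 = 10" and slope9: "(3::nat) ^ ups 9 13 < 2 ^ downs 9 13"
    unfolding funpow_slope_step by simp_all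
  then have "z \<le> (collatz ^^ 13) z"
    using iff xk by (simp add: z_def)
  moreover have "(3::nat) ^ ups z 13 < 2 ^ downs z 13"
    using slope9 ups_downs_cong[OF y(3), of k 13] n xk by (simp add: z_def)
  ultimately have "z < 260"
    using anomaly_small(1)[of z 13] by simp
  then have "2 ^ k * z < 2 ^ k * 260"
    by simp
  then show False
    using y(1) funpow_collatz_ge[of y k] unfolding z_def by linarith
qed

theorem mainTheorem4:
  assumes "collatz_conjecture"
  shows "(\<forall>n\<in>{1..14}. card (collatz_permutations n) = fib n) \<and>
         (\<forall>n\<ge>15. card (collatz_permutations n) > fib n)"
proof (intro conjI ballI allI impI)
  fix n :: nat
  assume "n \<in> {1..14}"
  then have n: "1 \<le> n" "n \<le> 14"
    by auto
  have "inj_on ascents (collatz_permutations n)"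
    unfolding collatz_permutations_eq_image[OF assms n(1)]
  proof (rule inj_onI, clarsimp)
    fix x y
    assume xy: "hits x n" "hits y n"
      and "ascents (collatz_permutation x) = ascents (collatz_permutation y)"
    then have "parity_word x n = parity_word y n"
      using n(1) by (simp add: ascents_collatz_permutation)
    then show "collatz_permutation x = collatz_permutation y"
      using collatz_permutation_eqI xy n by blast
  qed
  then show "card (collatz_permutations n) = fib n"
    using card_image ascents_image_collatz_permutations[OF assms n(1)] card_parity_words by metis
next
  fix n :: nat
  assume n: "n \<ge> 15"
  have fin: "finite (collatz_permutations n)"
    unfolding collatz_permutations_def by simp
  have "card (ascents ` collatz_permutations n) = fib n"
    using ascents_image_collatz_permutations[OF assms, of n] n card_parity_words by simp
  then show "card (collatz_permutations n) > fib n"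
    using card_image_le[OF fin, of ascents] eq_card_imp_inj_on[OF fin, of ascents]
      not_inj_on_ascents[OF assms n] by linarith
qed

end
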